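(* Let $\Gamma$ be a groupoid and $R$ a (object unital) $\Gamma$-graded ring. The following assertions are equivalent: (1) $R$ is a gr-semisimple ring. (2) $\mathrm{rad}^{\mathrm{gr}}(R)=0$ and $R$ is a right $\Gamma_0$-artinian ring. (3) $\mathrm{rad}^{\mathrm{gr}}(R)=0$ and $R$ satisfies the descending chain condition on gr-principal graded right ideals.
   Context: A groupoid $\Gamma$ is a small category in which every morphism is invertible. It is identified with its set of morphisms; $\Gamma_0$ is its set of objects, each object being identified with its identity morphism. For $\gamma\in\Gamma$, $d(\gamma)$ and $r(\gamma)$ denote domain and codomain, and $\delta\gamma$ is defined iff $d(\delta)=r(\gamma)$. Rings are associative, not necessarily unital. A $\Gamma$-graded ring is a ring $R=\bigoplus_{\gamma\in\Gamma}R_\gamma$ (additive subgroups) with $R_\gamma R_\delta\subseteq R_{\gamma\delta}$ if $\gamma\delta$ is defined and $R_\gamma R_\delta=0$ otherwise. All graded rings are assumed object unital: for each $e\in\Gamma_0$ the ring $R_e$ has an identity $1_e$ (possibly $0$), and $1_{r(\gamma)}a=a1_{d(\gamma)}=a$ for all $a\in R_\gamma$. A graded right ideal is a right ideal $U$ with $U=\bigoplus_\gamma(U\cap R_\gamma)$; it is viewed as a graded submodule of the right module $R_R$. The set of homogeneous elements is $\mathrm{h}(R)=\bigcup_\gamma R_\gamma$. A graded right ideal is gr-simple if it is nonzero and contains no graded right ideals other than $0$ and itself. $R$ is a gr-semisimple ring if $R_R$ is a sum of gr-simple graded right ideals. A graded right ideal is gr-maximal if it is maximal among the proper graded right ideals.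 $\mathrm{rad}^{\mathrm{gr}}(R)$ is the intersection of all gr-maximal graded right ideals of $R$ ($:=R$ if there are none); it coincides with the left-sided analogue. $R$ is right $\Gamma_0$-artinian if for each $e\in\Gamma_0$ the right module $R(e)=1_eR=\bigoplus_{r(\gamma)=e}R_\gamma$ satisfies the descending chain condition on graded submodules. A graded right ideal is gr-principal if it equals $aR$ for some $a\in\mathrm{h}(R)$. *)

theory Defs
  imports Main
begin

text \<open>
  A groupoid is identified with its set \<open>G\<close> of morphisms and each object with its identity
  morphism, so the domain \<open>d\<close> and the codomain \<open>r\<close> take values in \<open>G\<close>.
  The value \<open>cmp \<delta> \<gamma>\<close> stands for the composite \<open>\<delta>\<gamma>\<close>; it is meaningful only if
  \<open>d \<delta> = r \<gamma>\<close> and is unconstrained otherwise.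
\<close>

locale groupoid =
  fixes G :: "'g set"
    and d :: "'g \<Rightarrow> 'g"
    and r :: "'g \<Rightarrow> 'g"
    and cmp :: "'g \<Rightarrow> 'g \<Rightarrow> 'g"
  assumes d_closed: "\<gamma> \<in> G \<Longrightarrow> d \<gamma> \<in> G"
    and r_closed: "\<gamma> \<in> G \<Longrightarrow> r \<gamma> \<in> G"
    and d_d: "\<gamma> \<in> G \<Longrightarrow> d (d \<gamma>) = d \<gamma>"
    and r_d: "\<gamma> \<in> G \<Longrightarrow> r (d \<gamma>) = d \<gamma>"
    and d_r: "\<gamma> \<in> G \<Longrightarrow> d (r \<gamma>) = r \<gamma>"
    and r_r: "\<gamma> \<in> G \<Longrightarrow> r (r \<gamma>) = r \<gamma>"
    and cmp_closed: "\<lbrakk>\<delta> \<in> G; \<gamma> \<in> G; d \<delta> = r \<gamma>\<rbrakk> \<Longrightarrow> cmp \<delta> \<gamma> \<in> G"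
    and d_cmp: "\<lbrakk>\<delta> \<in> G; \<gamma> \<in> G; d \<delta> = r \<gamma>\<rbrakk> \<Longrightarrow> d (cmp \<delta> \<gamma>) = d \<gamma>"
    and r_cmp: "\<lbrakk>\<delta> \<in> G; \<gamma> \<in> G; d \<delta> = r \<gamma>\<rbrakk> \<Longrightarrow> r (cmp \<delta> \<gamma>) = r \<delta>"
    and cmp_assoc: "\<lbrakk>\<epsilon> \<in> G; \<delta> \<in> G; \<gamma> \<in> G; d \<epsilon> = r \<delta>; d \<delta> = r \<gamma>\<rbrakk>
      \<Longrightarrow> cmp (cmp \<epsilon> \<delta>) \<gamma> = cmp \<epsilon> (cmp \<delta> \<gamma>)"
    and cmp_d: "\<gamma> \<in> G \<Longrightarrow> cmp \<gamma> (d \<gamma>) = \<gamma>"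
    and r_cmp_id: "\<gamma> \<in> G \<Longrightarrow> cmp (r \<gamma>) \<gamma> = \<gamma>"
    and invertible: "\<gamma> \<in> G \<Longrightarrow>
      \<exists>\<delta>\<in>G. d \<delta> = r \<gamma> \<and> r \<delta> = d \<gamma> \<and> cmp \<delta> \<gamma> = d \<gamma> \<and> cmp \<gamma> \<delta> = r \<gamma>"

definition objects :: "'g set \<Rightarrow> ('g \<Rightarrow> 'g) \<Rightarrow> 'g set" where
  "objects G d = {e \<in> G. d e = e}"

definition add_subgroup :: "'a::ab_group_add set \<Rightarrow> bool" where
  "add_subgroup S \<longleftrightarrow> 0 \<in> S \<and> (\<forall>x\<in>S. \<forall>y\<in>S. x - y \<in> S)"

definition fin_supp_families :: "'i set \<Rightarrow> ('i \<Rightarrow> 'a::ab_group_add set) \<Rightarrow> ('i \<Rightarrow> 'a) set" where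
  "fin_supp_families I A =
     {f. (\<forall>i\<in>I. f i \<in> A i) \<and> (\<forall>i. i \<notin> I \<longrightarrow> f i = 0) \<and> finite {i. f i \<noteq> 0}}"

definition family_total :: "('i \<Rightarrow> 'a::ab_group_add) \<Rightarrow> 'a" where
  "family_total f = (\<Sum>i | f i \<noteq> 0. f i)"

definition internal_sum :: "'i set \<Rightarrow> ('i \<Rightarrow> 'a::ab_group_add set) \<Rightarrow> 'a set" where
  "internal_sum I A = family_total ` fin_supp_families I A"

definition internal_direct_sum :: "'i set \<Rightarrow> ('i \<Rightarrow> 'a::ab_group_add set) \<Rightarrow> 'a set \<Rightarrow> bool" where
  "internal_direct_sum I A U \<longleftrightarrow> bij_betw family_total (fin_supp_families I A) U"

text \<open>
  The ring is the whole type \<open>'a\<close>; the class \<open>ring\<close> requires neither an identity nor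
  nontriviality. \<open>R \<gamma>\<close> is the homogeneous component of degree \<open>\<gamma>\<close>, and \<open>un e\<close> is
  the (unique) identity \<open>1\<^sub>e\<close> of \<open>R e\<close>.
\<close>

locale object_unital_graded_ring = groupoid G d r cmp
  for G :: "'g set" and d r :: "'g \<Rightarrow> 'g" and cmp :: "'g \<Rightarrow> 'g \<Rightarrow> 'g" +
  fixes R :: "'g \<Rightarrow> 'a::ring set"
    and un :: "'g \<Rightarrow> 'a"
  assumes component_subgroup: "\<gamma> \<in> G \<Longrightarrow> add_subgroup (R \<gamma>)"
    and decomposition: "internal_direct_sum G R UNIV"
    and mult_composable: "\<lbrakk>\<gamma> \<in> G; \<delta> \<in> G; d \<gamma> = r \<delta>; a \<in> R \<gamma>; b \<in> R \<delta>\<rbrakk>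
      \<Longrightarrow> a * b \<in> R (cmp \<gamma> \<delta>)"
    and mult_not_composable: "\<lbrakk>\<gamma> \<in> G; \<delta> \<in> G; d \<gamma> \<noteq> r \<delta>; a \<in> R \<gamma>; b \<in> R \<delta>\<rbrakk>
      \<Longrightarrow> a * b = 0"
    and un_mem: "e \<in> objects G d \<Longrightarrow> un e \<in> R e"
    and un_left: "\<lbrakk>\<gamma> \<in> G; a \<in> R \<gamma>\<rbrakk> \<Longrightarrow> un (r \<gamma>) * a = a"
    and un_right: "\<lbrakk>\<gamma> \<in> G; a \<in> R \<gamma>\<rbrakk> \<Longrightarrow> a * un (d \<gamma>) = a"

definition homogeneous :: "'g set \<Rightarrow> ('g \<Rightarrow> 'a::ring set) \<Rightarrow> 'a set" where
  "homogeneous G R = (\<Union>\<gamma>\<in>G. R \<gamma>)"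

definition right_ideal :: "'a::ring set \<Rightarrow> bool" where
  "right_ideal U \<longleftrightarrow> add_subgroup U \<and> (\<forall>u\<in>U. \<forall>x. u * x \<in> U)"

definition gr_right_ideal :: "'g set \<Rightarrow> ('g \<Rightarrow> 'a::ring set) \<Rightarrow> 'a set \<Rightarrow> bool" where
  "gr_right_ideal G R U \<longleftrightarrow>
     right_ideal U \<and> internal_direct_sum G (\<lambda>\<gamma>. U \<inter> R \<gamma>) U"

definition gr_simple :: "'g set \<Rightarrow> ('g \<Rightarrow> 'a::ring set) \<Rightarrow> 'a set \<Rightarrow> bool" where
  "gr_simple G R U \<longleftrightarrow> gr_right_ideal G R U \<and> U \<noteq> {0} \<and>
     (\<forall>V. gr_right_ideal G R V \<and> V \<subseteq> U \<longrightarrow> V = {0} \<or> V = U)"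

definition gr_semisimple_ring :: "'g set \<Rightarrow> ('g \<Rightarrow> 'a::ring set) \<Rightarrow> bool" where
  "gr_semisimple_ring G R \<longleftrightarrow>
     (\<exists>\<S>. (\<forall>U\<in>\<S>. gr_simple G R U) \<and> internal_sum \<S> (\<lambda>U. U) = UNIV)"

definition gr_maximal :: "'g set \<Rightarrow> ('g \<Rightarrow> 'a::ring set) \<Rightarrow> 'a set \<Rightarrow> bool" where
  "gr_maximal G R U \<longleftrightarrow> gr_right_ideal G R U \<and> U \<noteq> UNIV \<and>
     (\<forall>V. gr_right_ideal G R V \<and> V \<noteq> UNIV \<and> U \<subseteq> V \<longrightarrow> V = U)"

text \<open>
  If there are no gr-maximal graded right ideals, the empty intersection is \<open>UNIV\<close>, that is,
  the whole ring, as the convention for the radical demands.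
\<close>

definition gr_radical :: "'g set \<Rightarrow> ('g \<Rightarrow> 'a::ring set) \<Rightarrow> 'a set" where
  "gr_radical G R = \<Inter> {U. gr_maximal G R U}"

definition dcc :: "('a set \<Rightarrow> bool) \<Rightarrow> bool" where
  "dcc P \<longleftrightarrow> (\<forall>U :: nat \<Rightarrow> 'a set. (\<forall>n. P (U n)) \<and> (\<forall>n. U (Suc n) \<subseteq> U n) \<longrightarrow>
     (\<exists>N. \<forall>n\<ge>N. U n = U N))"

definition right_mult_set :: "'a::ring \<Rightarrow> 'a set" where
  "right_mult_set a = range (\<lambda>x. a * x)"

text \<open>
  The graded submodules of \<open>R(e) = 1\<^sub>e R\<close> are the graded right ideals contained in it.
\<close>

definition right_objects_artinian ::
    "'g set \<Rightarrow> ('g \<Rightarrow> 'g) \<Rightarrow> ('g \<Rightarrow> 'a::ring set) \<Rightarrow> ('g \<Rightarrow> 'a) \<Rightarrow> bool" where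
  "right_objects_artinian G d R un \<longleftrightarrow>
     (\<forall>e\<in>objects G d. dcc (\<lambda>U. gr_right_ideal G R U \<and> U \<subseteq> right_mult_set (un e)))"

definition gr_principal :: "'g set \<Rightarrow> ('g \<Rightarrow> 'a::ring set) \<Rightarrow> 'a set \<Rightarrow> bool" where
  "gr_principal G R U \<longleftrightarrow>
     gr_right_ideal G R U \<and> (\<exists>a\<in>homogeneous G R. U = right_mult_set a)"

end

theory Submission
  imports Defs "HOL-Library.Set_Algebras"
begin

text \<open>
  The proof runs through the cycle (1) \<open>\<Rightarrow>\<close> (2) \<open>\<Rightarrow>\<close> (3) \<open>\<Rightarrow>\<close> (1). Throughout, a right ideal is graded
  exactly when it contains the homogeneous components of its elements
  (\<open>gr_right_ideal_iff\<close>); this makes graded right ideals closed under intersections, sums and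
  unions of chains, so that they form a modular lattice.

  Let \<open>R\<close> be a sum of gr-simple right ideals. For \<open>a \<noteq> 0\<close>, Zorn's lemma gives a graded right ideal
  \<open>M\<close> that is maximal among those avoiding \<open>a\<close>. It is gr-maximal: if \<open>M \<subset> V \<subset> R\<close>, then \<open>a \<in> V\<close>,
  and some gr-simple \<open>S\<close> meets \<open>V\<close> in \<open>0\<close>; by the modular law \<open>(M + S) \<inter> V = M\<close>, so
  \<open>M + S\<close> is a larger graded right ideal avoiding \<open>a\<close>. Hence the radical is zero
  (\<open>gr_radical_zero_if_semisimple\<close>). Moreover each \<open>1\<^sub>e\<close> lies in a sum of finitely many gr-simple
  right ideals, and such a sum satisfies the descending chain condition, by induction on the number
  of summands (\<open>finite_gr_simple_sum_dcc\<close>). This gives (2).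

  Statement (3) follows from (2) because \<open>aR\<close> lies in \<open>1\<^sub>e R\<close> with \<open>e\<close> the codomain of the degree
  of \<open>a\<close>, so that a whole descending chain of gr-principal right ideals lives inside one \<open>1\<^sub>e R\<close>.

  Now assume (3). A minimal nonzero gr-principal right ideal is gr-simple, so every nonzero
  gr-principal right ideal contains a gr-simple one. Because the radical is zero, every gr-simple
  right ideal \<open>S\<close> has a gr-maximal \<open>M\<close> with \<open>S \<inter> M = 0\<close> and \<open>S + M = R\<close>. Given a homogeneous
  element \<open>a\<close>, choose \<open>f\<close> of the same degree with \<open>f \<equiv> a\<close> modulo the sum of all gr-simple right
  ideals and with \<open>fR\<close> minimal. If \<open>f \<noteq> 0\<close>, take \<open>S \<subseteq> fR\<close> and \<open>M\<close> as above and write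
  \<open>f = s + m\<close> with \<open>s \<in> S\<close> and \<open>m \<in> M\<close> of the same degree as \<open>f\<close>; then \<open>m\<close> is congruent to \<open>a\<close> as well, and \<open>mR\<close> is strictly smaller than \<open>fR\<close>,
  since it lies in \<open>M\<close> and so cannot contain \<open>S\<close>. Hence \<open>f = 0\<close>, and \<open>a\<close> is in the sum of the
  gr-simple right ideals (\<open>gr_semisimple_if_dcc_principal\<close>).
\<close>

section \<open>Additive subgroups, internal sums and right ideals\<close>

lemma add_subgroup_zero: "add_subgroup S \<Longrightarrow> 0 \<in> S"
  by (simp add: add_subgroup_def)

lemma add_subgroup_diff: "\<lbrakk>add_subgroup S; x \<in> S; y \<in> S\<rbrakk> \<Longrightarrow> x - y \<in> S"
  by (simp add: add_subgroup_def)

lemma add_subgroup_add: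
  assumes "add_subgroup S" "x \<in> S" "y \<in> S"
  shows "x + y \<in> S"
proof -
  have "x - (0 - y) \<in> S"
    using assms by (blast intro: add_subgroup_zero add_subgroup_diff)
  then show ?thesis by simp
qed

lemma add_subgroup_sum:
  assumes "add_subgroup S" "\<And>i. i \<in> I \<Longrightarrow> f i \<in> S"
  shows "sum f I \<in> S"
  using assms(2)
  by (induction I rule: infinite_finite_induct)
    (auto intro: add_subgroup_zero add_subgroup_add assms(1))

lemma add_subgroup_Int: "\<lbrakk>add_subgroup S; add_subgroup T\<rbrakk> \<Longrightarrow> add_subgroup (S \<inter> T)"
  by (simp add: add_subgroup_def)

lemma add_subgroup_set_plus:
  assumes "add_subgroup S" "add_subgroup T"
  shows "add_subgroup (S + T)"
  unfolding add_subgroup_def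
proof (intro conjI ballI)
  show "0 \<in> S + T"
    using set_plus_intro[of 0 S 0 T] assms by (simp add: add_subgroup_zero)
next
  fix x y assume "x \<in> S + T" "y \<in> S + T"
  then obtain s t s' t' where xy:
    "x = s + t" "y = s' + t'" "s \<in> S" "t \<in> T" "s' \<in> S" "t' \<in> T"
    by (auto elim!: set_plus_elim)
  have eq: "x - y = (s - s') + (t - t')"
    by (simp add: xy algebra_simps)
  show "x - y \<in> S + T"
    unfolding eq by (intro set_plus_intro add_subgroup_diff assms xy)
qed

lemma subset_set_plus_left: "add_subgroup T \<Longrightarrow> S \<subseteq> S + T"
  using set_plus_intro[of _ S 0 T] add_subgroup_zero by fastforce

lemma subset_set_plus_right: "add_subgroup S \<Longrightarrow> T \<subseteq> S + T"
  using set_plus_intro[of 0 S _ T] add_subgroup_zero by fastforce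

lemma family_total_eq_sum:
  assumes "finite A" "{i. f i \<noteq> 0} \<subseteq> A"
  shows "family_total f = sum f A"
  unfolding family_total_def using assms by (intro sum.mono_neutral_left) auto

lemma family_total_diff:
  assumes "finite {i. f i \<noteq> 0}" "finite {i. g i \<noteq> 0}"
  shows "family_total (\<lambda>i. f i - g i) = family_total f - family_total g"
proof -
  let ?A = "{i. f i \<noteq> 0} \<union> {i. g i \<noteq> 0}"
  have "finite ?A" using assms by simp
  then have "family_total f = sum f ?A" "family_total g = sum g ?A"
    "family_total (\<lambda>i. f i - g i) = (\<Sum>i\<in>?A. f i - g i)"
    by (auto intro!: family_total_eq_sum)
  then show ?thesis by (simp add: sum_subtractf)
qed

lemma fin_supp_families_diff:
  assumes "\<And>i. i \<in> I \<Longrightarrow> add_subgroup (A i)"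
    and f: "f \<in> fin_supp_families I A" and g: "g \<in> fin_supp_families I A"
  shows "(\<lambda>i. f i - g i) \<in> fin_supp_families I A"
proof -
  have "{i. f i - g i \<noteq> 0} \<subseteq> {i. f i \<noteq> 0} \<union> {i. g i \<noteq> 0}" by auto
  then have "finite {i. f i - g i \<noteq> 0}"
    using f g by (auto simp: fin_supp_families_def intro: finite_subset)
  then show ?thesis
    using assms by (auto simp: fin_supp_families_def intro: add_subgroup_diff)
qed

lemma single_mem_fin_supp_families:
  assumes "\<And>i. i \<in> I \<Longrightarrow> add_subgroup (A i)" "k \<in> I" "x \<in> A k"
  shows "(\<lambda>i. if i = k then x else 0) \<in> fin_supp_families I A"
  using assms by (auto simp: fin_supp_families_def add_subgroup_zero)

lemma family_total_single: "family_total (\<lambda>i. if i = k then x else 0) = x"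
  by (subst family_total_eq_sum[where A = "{k}"]) auto

lemma internal_sum_add_subgroup:
  assumes "\<And>i. i \<in> I \<Longrightarrow> add_subgroup (A i)"
  shows "add_subgroup (internal_sum I A)"
  unfolding add_subgroup_def
proof (intro conjI ballI)
  have "(\<lambda>i. 0) \<in> fin_supp_families I A"
    using assms by (auto simp: fin_supp_families_def add_subgroup_zero)
  moreover have "family_total (\<lambda>i. 0) = 0" by (simp add: family_total_def)
  ultimately show "0 \<in> internal_sum I A" unfolding internal_sum_def by force
next
  fix x y assume "x \<in> internal_sum I A" "y \<in> internal_sum I A"
  then obtain f g where f: "f \<in> fin_supp_families I A" "x = family_total f"
    and g: "g \<in> fin_supp_families I A" "y = family_total g"
    by (auto simp: internal_sum_def)
  have "family_total (\<lambda>i. f i - g i) = x - y"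
    using f g by (simp add: family_total_diff fin_supp_families_def)
  then show "x - y \<in> internal_sum I A"
    using fin_supp_families_diff[OF assms f(1) g(1)] unfolding internal_sum_def by force
qed

lemma internal_sum_upper:
  assumes "\<And>i. i \<in> I \<Longrightarrow> add_subgroup (A i)" "k \<in> I"
  shows "A k \<subseteq> internal_sum I A"
proof
  fix x assume "x \<in> A k"
  then show "x \<in> internal_sum I A"
    using single_mem_fin_supp_families[where A = A and x = x, OF assms]
      family_total_single[where x = x and k = k, symmetric]
    unfolding internal_sum_def by (blast intro: image_eqI)
qed

lemma internal_sum_least:
  assumes "add_subgroup V" "\<And>i. i \<in> I \<Longrightarrow> A i \<subseteq> V"
  shows "internal_sum I A \<subseteq> V"
proof
  fix x assume "x \<in> internal_sum I A"
  then obtain f where f: "f \<in> fin_supp_families I A" "x = family_total f"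
    by (auto simp: internal_sum_def)
  have "f i \<in> V" if "f i \<noteq> 0" for i
    using that f(1) assms(2)[of i] by (auto simp: fin_supp_families_def)
  then show "x \<in> V"
    unfolding f(2) family_total_def by (intro add_subgroup_sum[OF assms(1)]) simp
qed

lemma right_ideal_add_subgroup: "right_ideal U \<Longrightarrow> add_subgroup U"
  by (simp add: right_ideal_def)

lemma right_mult_set_subset: "\<lbrakk>right_ideal U; a \<in> U\<rbrakk> \<Longrightarrow> right_mult_set a \<subseteq> U"
  by (auto simp: right_ideal_def right_mult_set_def)

lemma right_ideal_right_mult_set: "right_ideal (right_mult_set (a :: 'a::ring))"
  unfolding right_ideal_def add_subgroup_def
proof (intro conjI ballI allI)
  show "0 \<in> right_mult_set a"
    unfolding right_mult_set_def by (rule range_eqI[where x = 0]) simp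
next
  fix x y assume "x \<in> right_mult_set a" "y \<in> right_mult_set a"
  then show "x - y \<in> right_mult_set a"
    unfolding right_mult_set_def by (metis (no_types, lifting) rangeE rangeI right_diff_distrib)
next
  fix x y assume "x \<in> right_mult_set a"
  then show "x * y \<in> right_mult_set a"
    unfolding right_mult_set_def by (metis (no_types, lifting) rangeE rangeI mult.assoc)
qed

lemma right_ideal_set_plus:
  assumes "right_ideal U" "right_ideal V"
  shows "right_ideal (U + V)"
  using assms add_subgroup_set_plus[of U V]
  by (force simp: right_ideal_def distrib_right elim!: set_plus_elim)

text \<open>
  This is the modular law for subgroups, in the form that serves chain conditions: a descending
  chain becomes stationary once its traces on \<open>N\<close> and its sums with \<open>N\<close> do.
\<close>

lemma modular_cancel:
  assumes "add_subgroup K" "add_subgroup K'" "add_subgroup N" "K \<subseteq> K'"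
    and "K \<inter> N = K' \<inter> N" "K + N = K' + N"
  shows "K = K'"
proof
  show "K' \<subseteq> K"
  proof
    fix x assume x: "x \<in> K'"
    then have "x \<in> K + N" using subset_set_plus_left[OF assms(3)] assms(6) by blast
    then obtain k n where kn: "x = k + n" "k \<in> K" "n \<in> N" by (rule set_plus_elim)
    have "x - k \<in> K'" using x kn(2) assms(2,4) by (blast intro: add_subgroup_diff)
    then have "n \<in> K" using kn assms(5) by auto
    then show "x \<in> K" using kn assms(1) by (auto intro: add_subgroup_add)
  qed
qed (rule assms(4))

section \<open>Descending chain conditions\<close>

lemma dcc_mono: "\<lbrakk>dcc P; \<And>U. Q U \<Longrightarrow> P U\<rbrakk> \<Longrightarrow> dcc Q"
  unfolding dcc_def by blast

lemma dccD:
  assumes "dcc P" "\<And>n. P (U n)" "\<And>n. U (Suc n) \<subseteq> U n"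
  shows "\<exists>N. \<forall>n\<ge>N. U n = U N"
  using assms unfolding dcc_def by blast

lemma dcc_minimal:
  assumes "dcc P" "P U" "Q U"
  shows "\<exists>V. P V \<and> Q V \<and> (\<forall>W. P W \<longrightarrow> Q W \<longrightarrow> W \<subseteq> V \<longrightarrow> W = V)"
proof -
  let ?r = "{(W, V). P W \<and> P V \<and> W \<subset> V}"
  have "wf ?r"
    unfolding wf_iff_no_infinite_down_chain
  proof
    assume "\<exists>f. \<forall>i. (f (Suc i), f i) \<in> ?r"
    then obtain f where f: "\<And>i. P (f i)" "\<And>i. f (Suc i) \<subset> f i" by blast
    have "\<exists>N. \<forall>n\<ge>N. f n = f N"
      by (rule dccD[OF assms(1)]) (use f in blast)+
    then obtain N where "\<forall>n\<ge>N. f n = f N" by (rule exE)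
    then have "f (Suc N) = f N" by (rule allE[of _ "Suc N"]) simp
    then show False using f(2)[of N] by simp
  qed
  moreover have "U \<in> {V. P V \<and> Q V}" using assms by simp
  ultimately obtain V where V: "V \<in> {V. P V \<and> Q V}"
    "\<And>W. (W, V) \<in> ?r \<Longrightarrow> W \<notin> {V. P V \<and> Q V}"
    by (rule wfE_min) blast
  then show ?thesis by blast
qed

section \<open>Homogeneous components and graded right ideals\<close>

context object_unital_graded_ring
begin

text \<open>
  \<open>hcomp x\<close> is the family of homogeneous components of \<open>x\<close>, with value \<open>0\<close> outside \<open>G\<close>.
\<close>

definition hcomp :: "'a \<Rightarrow> 'g \<Rightarrow> 'a" where
  "hcomp x = the_inv_into (fin_supp_families G R) family_total x"

lemma family_total_bij: "bij_betw family_total (fin_supp_families G R) UNIV"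
  using decomposition by (simp add: internal_direct_sum_def)

lemma hcomp_family: "hcomp x \<in> fin_supp_families G R"
  unfolding hcomp_def using bij_betw_the_inv_into[OF family_total_bij]
  by (rule bij_betwE[THEN bspec]) simp

lemma family_total_hcomp: "family_total (hcomp x) = x"
  unfolding hcomp_def by (rule f_the_inv_into_f_bij_betw[OF family_total_bij]) simp

lemma hcomp_unique: "f \<in> fin_supp_families G R \<Longrightarrow> hcomp (family_total f) = f"
  unfolding hcomp_def by (rule the_inv_into_f_f[OF bij_betw_imp_inj_on[OF family_total_bij]])

lemma hcomp_mem: "\<gamma> \<in> G \<Longrightarrow> hcomp x \<gamma> \<in> R \<gamma>"
  using hcomp_family[of x] by (simp add: fin_supp_families_def)

lemma hcomp_outside: "\<gamma> \<notin> G \<Longrightarrow> hcomp x \<gamma> = 0"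
  using hcomp_family[of x] by (simp add: fin_supp_families_def)

lemma hcomp_diff: "hcomp (x - y) \<gamma> = hcomp x \<gamma> - hcomp y \<gamma>"
proof -
  have "family_total (\<lambda>i. hcomp x i - hcomp y i) = x - y"
    using hcomp_family[of x] hcomp_family[of y]
    by (simp add: family_total_diff family_total_hcomp fin_supp_families_def)
  moreover have "(\<lambda>i. hcomp x i - hcomp y i) \<in> fin_supp_families G R"
    by (intro fin_supp_families_diff component_subgroup hcomp_family)
  ultimately show ?thesis using hcomp_unique by (metis (no_types, lifting))
qed

lemma hcomp_zero: "hcomp 0 \<gamma> = 0"
  using hcomp_diff[of 0 0 \<gamma>] by simp

lemma hcomp_add: "hcomp (x + y) \<gamma> = hcomp x \<gamma> + hcomp y \<gamma>"
  using hcomp_diff[of "x + y" y \<gamma>] by simp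

lemma hcomp_sum: "hcomp (sum f I) \<gamma> = (\<Sum>i\<in>I. hcomp (f i) \<gamma>)"
  by (induction I rule: infinite_finite_induct) (auto simp: hcomp_zero hcomp_add)

lemma hcomp_homogeneous:
  assumes "\<gamma> \<in> G" "a \<in> R \<gamma>"
  shows "hcomp a \<kappa> = (if \<kappa> = \<gamma> then a else 0)"
  using hcomp_unique[OF single_mem_fin_supp_families[where A = R, OF component_subgroup assms]]
  by (simp add: family_total_single)

text \<open>
  Since the decomposition of an element is unique in the whole ring, a decomposition inside \<open>U\<close>
  can only be the one into homogeneous components.
\<close>

lemma gr_right_ideal_iff:
  "gr_right_ideal G R U \<longleftrightarrow> right_ideal U \<and> (\<forall>x\<in>U. \<forall>\<gamma>. hcomp x \<gamma> \<in> U)"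
proof -
  let ?F = "fin_supp_families G (\<lambda>\<gamma>. U \<inter> R \<gamma>)"
  have sub: "?F \<subseteq> fin_supp_families G R"
    by (auto simp: fin_supp_families_def)
  have inj: "inj_on family_total ?F"
    using bij_betw_imp_inj_on[OF family_total_bij] sub by (rule inj_on_subset)
  have "internal_direct_sum G (\<lambda>\<gamma>. U \<inter> R \<gamma>) U \<longleftrightarrow> (\<forall>x\<in>U. \<forall>\<gamma>. hcomp x \<gamma> \<in> U)"
    if U: "right_ideal U"
  proof
    note U' = right_ideal_add_subgroup[OF U]
    assume *: "internal_direct_sum G (\<lambda>\<gamma>. U \<inter> R \<gamma>) U"
    show "\<forall>x\<in>U. \<forall>\<gamma>. hcomp x \<gamma> \<in> U"
    proof (intro ballI allI)
      fix x \<gamma> assume "x \<in> U"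
      then obtain f where f: "f \<in> ?F" "x = family_total f"
        using * by (auto simp: internal_direct_sum_def bij_betw_def)
      then have "hcomp x = f" using sub hcomp_unique by blast
      then show "hcomp x \<gamma> \<in> U"
        using f(1) add_subgroup_zero[OF U']
        by (cases "\<gamma> \<in> G") (auto simp: fin_supp_families_def)
    qed
  next
    note U' = right_ideal_add_subgroup[OF U]
    assume *: "\<forall>x\<in>U. \<forall>\<gamma>. hcomp x \<gamma> \<in> U"
    have "family_total ` ?F \<subseteq> U"
      using internal_sum_least[OF U', of G "\<lambda>\<gamma>. U \<inter> R \<gamma>"] by (auto simp: internal_sum_def)
    moreover have "hcomp x \<in> ?F" if "x \<in> U" for x
      using * that hcomp_family[of x] by (simp add: fin_supp_families_def)
    then have "U \<subseteq> family_total ` ?F"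
      using family_total_hcomp by (metis image_eqI subsetI)
    ultimately show "internal_direct_sum G (\<lambda>\<gamma>. U \<inter> R \<gamma>) U"
      using inj by (auto simp: internal_direct_sum_def bij_betw_def)
  qed
  then show ?thesis by (auto simp: gr_right_ideal_def)
qed

lemma gr_right_idealD:
  assumes "gr_right_ideal G R U"
  shows "right_ideal U" "add_subgroup U"
  using assms by (simp_all add: gr_right_ideal_def right_ideal_def)

lemma gr_right_ideal_zero: "gr_right_ideal G R {0}"
  by (simp add: gr_right_ideal_iff hcomp_zero right_ideal_def add_subgroup_def)

lemma gr_right_ideal_Int:
  "\<lbrakk>gr_right_ideal G R U; gr_right_ideal G R V\<rbrakk> \<Longrightarrow> gr_right_ideal G R (U \<inter> V)"
  by (simp add: gr_right_ideal_iff right_ideal_def add_subgroup_Int)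

lemma gr_right_ideal_set_plus:
  "\<lbrakk>gr_right_ideal G R U; gr_right_ideal G R V\<rbrakk> \<Longrightarrow> gr_right_ideal G R (U + V)"
  by (auto simp: gr_right_ideal_iff right_ideal_set_plus hcomp_add
      elim!: set_plus_elim intro!: set_plus_intro)

lemma gr_right_ideal_Union_chain:
  assumes "\<C> \<noteq> {}" "\<And>U. U \<in> \<C> \<Longrightarrow> gr_right_ideal G R U"
    and chain: "\<And>U V. \<lbrakk>U \<in> \<C>; V \<in> \<C>\<rbrakk> \<Longrightarrow> U \<subseteq> V \<or> V \<subseteq> U"
  shows "gr_right_ideal G R (\<Union>\<C>)"
proof -
  have ideal: "right_ideal U" "add_subgroup U" if "U \<in> \<C>" for U
    using assms(2)[OF that] gr_right_idealD by simp_all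
  show ?thesis
    unfolding gr_right_ideal_iff right_ideal_def add_subgroup_def
  proof (intro conjI ballI allI)
    show "0 \<in> \<Union>\<C>" using assms(1) ideal(2) add_subgroup_zero by blast
  next
    fix x y assume "x \<in> \<Union>\<C>" "y \<in> \<Union>\<C>"
    then obtain U where "U \<in> \<C>" "x \<in> U" "y \<in> U" using chain by blast
    then show "x - y \<in> \<Union>\<C>" using add_subgroup_diff[OF ideal(2)] by blast
  next
    fix x y assume "x \<in> \<Union>\<C>"
    then show "x * y \<in> \<Union>\<C>" using ideal(1) by (auto simp: right_ideal_def)
  next
    fix x \<gamma> assume "x \<in> \<Union>\<C>"
    then show "hcomp x \<gamma> \<in> \<Union>\<C>" using assms(2) by (auto simp: gr_right_ideal_iff)
  qed
qed

text \<open>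
  Left multiplication by a homogeneous element sends homogeneous elements to homogeneous ones, so
  the components of \<open>ax\<close> are sums of products of \<open>a\<close> with components of \<open>x\<close>.
\<close>

lemma gr_right_ideal_right_mult_set:
  assumes "\<gamma> \<in> G" "a \<in> R \<gamma>"
  shows "gr_right_ideal G R (right_mult_set a)"
  unfolding gr_right_ideal_iff
proof (intro conjI ballI allI)
  show ideal: "right_ideal (right_mult_set a)" by (rule right_ideal_right_mult_set)
  note subgroup = right_ideal_add_subgroup[OF ideal]
  fix y \<kappa> assume "y \<in> right_mult_set a"
  then obtain x where y: "y = a * x" by (auto simp: right_mult_set_def)
  have "x = (\<Sum>\<delta> | hcomp x \<delta> \<noteq> 0. hcomp x \<delta>)"
    using family_total_hcomp[of x] by (simp add: family_total_def)
  then have "y = (\<Sum>\<delta> | hcomp x \<delta> \<noteq> 0. a * hcomp x \<delta>)"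
    unfolding y by (metis (no_types, lifting) sum.cong sum_distrib_left)
  moreover have "hcomp (a * hcomp x \<delta>) \<kappa> \<in> right_mult_set a" if "\<delta> \<in> G" for \<delta>
  proof (cases "d \<gamma> = r \<delta>")
    case True
    then have "a * hcomp x \<delta> \<in> R (cmp \<gamma> \<delta>)" "cmp \<gamma> \<delta> \<in> G"
      using assms that hcomp_mem by (auto intro: mult_composable cmp_closed)
    then show ?thesis
      using add_subgroup_zero[OF subgroup]
      by (simp add: hcomp_homogeneous) (simp add: right_mult_set_def)
  next
    case False
    then have "a * hcomp x \<delta> = 0"
      using assms that hcomp_mem by (auto intro: mult_not_composable)
    then show ?thesis using add_subgroup_zero[OF subgroup] by (simp add: hcomp_zero)
  qed
  moreover have "\<delta> \<in> G" if "hcomp x \<delta> \<noteq> 0" for \<delta>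
    using that hcomp_outside by blast
  ultimately show "hcomp y \<kappa> \<in> right_mult_set a"
    by (auto simp: hcomp_sum intro!: add_subgroup_sum[OF subgroup])
qed

lemma gr_principal_right_mult_set:
  "\<lbrakk>\<gamma> \<in> G; a \<in> R \<gamma>\<rbrakk> \<Longrightarrow> gr_principal G R (right_mult_set a)"
  using gr_right_ideal_right_mult_set unfolding gr_principal_def homogeneous_def by blast

lemma mem_right_mult_set: "\<lbrakk>\<gamma> \<in> G; a \<in> R \<gamma>\<rbrakk> \<Longrightarrow> a \<in> right_mult_set a"
  unfolding right_mult_set_def by (metis un_right rangeI)

lemma nonzero_homogeneous_mem:
  assumes "gr_right_ideal G R U" "U \<noteq> {0}"
  obtains \<gamma> b where "\<gamma> \<in> G" "b \<in> R \<gamma>" "b \<in> U" "b \<noteq> 0"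
proof -
  obtain x where x: "x \<in> U" "x \<noteq> 0"
    using assms gr_right_idealD(2) add_subgroup_zero by blast
  have "\<exists>\<gamma>. hcomp x \<gamma> \<noteq> 0"
  proof (rule ccontr)
    assume "\<nexists>\<gamma>. hcomp x \<gamma> \<noteq> 0"
    then have "family_total (hcomp x) = 0" by (simp add: family_total_def)
    then show False using x(2) by (simp add: family_total_hcomp)
  qed
  then obtain \<gamma> where "hcomp x \<gamma> \<noteq> 0" by blast
  moreover from this have "\<gamma> \<in> G" using hcomp_outside by blast
  ultimately show ?thesis
    using that[of \<gamma> "hcomp x \<gamma>"] assms(1) x(1) hcomp_mem by (simp add: gr_right_ideal_iff)
qed

section \<open>Sums of gr-simple right ideals\<close>

lemma gr_simpleD: "gr_simple G R S \<Longrightarrow> gr_right_ideal G R S"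
  by (simp add: gr_simple_def)

lemma gr_simple_Int_trivial:
  assumes "gr_simple G R S" "gr_right_ideal G R V" "\<not> S \<subseteq> V"
  shows "S \<inter> V = {0}"
  using assms gr_right_ideal_Int[of S V] unfolding gr_simple_def by blast

text \<open>
  A chain below \<open>N + S\<close> is controlled by its traces on \<open>N\<close> and by the ideals \<open>S \<inter> (K\<^sub>n + N)\<close>,
  which are all \<open>0\<close> or \<open>S\<close>.
\<close>

lemma dcc_set_plus_gr_simple:
  assumes N: "gr_right_ideal G R N" and S: "gr_simple G R S"
    and dcc_N: "dcc (\<lambda>U. gr_right_ideal G R U \<and> U \<subseteq> N)"
  shows "dcc (\<lambda>U. gr_right_ideal G R U \<and> U \<subseteq> N + S)"
  unfolding dcc_def
proof (intro allI impI, elim conjE)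
  fix K :: "nat \<Rightarrow> 'a set"
  assume "\<forall>n. gr_right_ideal G R (K n) \<and> K n \<subseteq> N + S" and desc: "\<forall>n. K (Suc n) \<subseteq> K n"
  then have K: "\<And>n. gr_right_ideal G R (K n)" "\<And>n. K n \<subseteq> N + S" by simp_all
  have antimono: "K n \<subseteq> K m" if "m \<le> n" for m n
    using lift_Suc_antimono_le[of K m n] desc that by simp
  have N': "add_subgroup N" by (rule gr_right_idealD(2)[OF N])
  have trace: "gr_right_ideal G R (K n \<inter> N) \<and> K n \<inter> N \<subseteq> N" for n
    using gr_right_ideal_Int[OF K(1) N] by blast
  have trace_desc: "K (Suc n) \<inter> N \<subseteq> K n \<inter> N" for n
    using desc by blast
  obtain n\<^sub>1 where n\<^sub>1: "\<forall>n\<ge>n\<^sub>1. K n \<inter> N = K n\<^sub>1 \<inter> N"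
    using dccD[OF dcc_N, of "\<lambda>n. K n \<inter> N", OF trace trace_desc] by (rule exE)
  define T where "T n = S \<inter> (K n + N)" for n
  have T: "T n = {0} \<or> T n = S" for n
  proof -
    have "gr_right_ideal G R (T n)"
      unfolding T_def
      by (rule gr_right_ideal_Int[OF gr_simpleD[OF S] gr_right_ideal_set_plus[OF K(1) N]])
    moreover have "T n \<subseteq> S" by (simp add: T_def)
    ultimately show ?thesis using S by (simp add: gr_simple_def)
  qed
  have T_antimono: "T n \<subseteq> T m" if "m \<le> n" for m n
    using set_plus_mono2[OF antimono[OF that] order_refl[of N]] unfolding T_def by blast
  have zero_T: "0 \<in> T n" for n
    using T[of n] add_subgroup_zero[OF gr_right_idealD(2)[OF gr_simpleD[OF S]]] by auto
  obtain n\<^sub>2 where n\<^sub>2: "\<And>n. n \<ge> n\<^sub>2 \<Longrightarrow> T n = T n\<^sub>2"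
  proof (cases "\<exists>m. T m = {0}")
    case True
    then obtain m where "T m = {0}" by blast
    then have "T n = T m" if "n \<ge> m" for n
      using T_antimono[OF that] zero_T[of n] by auto
    then show ?thesis by (rule that)
  next
    case False
    then have "T n = S" for n using T[of n] by simp
    then show ?thesis using that[of 0] by simp
  qed
  \<comment> \<open>Modular law: \<open>K\<^sub>n + N\<close> lies between \<open>N\<close> and \<open>N + S\<close>, so it is recovered from its trace on \<open>S\<close>.\<close>
  have plus: "K n + N = N + T n" for n
  proof
    have sum: "add_subgroup (K n + N)"
      by (rule add_subgroup_set_plus[OF gr_right_idealD(2)[OF K(1)] N'])
    have N_sub: "N \<subseteq> K n + N" by (rule subset_set_plus_right[OF gr_right_idealD(2)[OF K(1)]])
    show "K n + N \<subseteq> N + T n"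
    proof
      fix x assume x: "x \<in> K n + N"
      then obtain k u where ku: "x = k + u" "k \<in> K n" "u \<in> N" by (rule set_plus_elim)
      have "k \<in> N + S" using K(2) ku(2) by (rule subsetD)
      then obtain v s where vs: "k = v + s" "v \<in> N" "s \<in> S" by (rule set_plus_elim)
      have eq: "x = (v + u) + s" by (simp add: ku(1) vs(1) algebra_simps)
      have vu: "v + u \<in> N" by (rule add_subgroup_add[OF N' vs(2) ku(3)])
      have "x - (v + u) \<in> K n + N"
        by (rule add_subgroup_diff[OF sum x subsetD[OF N_sub vu]])
      moreover have "x - (v + u) = s" by (simp add: eq)
      ultimately have "s \<in> T n" using vs(3) by (simp add: T_def)
      then show "x \<in> N + T n" unfolding eq by (rule set_plus_intro[OF vu])
    qed
    show "N + T n \<subseteq> K n + N"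
    proof
      fix x assume "x \<in> N + T n"
      then obtain u s where us: "x = u + s" "u \<in> N" "s \<in> T n" by (rule set_plus_elim)
      have "u \<in> K n + N" using N_sub us(2) by (rule subsetD)
      moreover have "s \<in> K n + N" using us(3) by (simp add: T_def)
      ultimately show "x \<in> K n + N" unfolding us(1) by (rule add_subgroup_add[OF sum])
    qed
  qed
  let ?m = "max n\<^sub>1 n\<^sub>2"
  have "K n = K ?m" if "n \<ge> ?m" for n
  proof (rule modular_cancel)
    show "add_subgroup (K n)" "add_subgroup (K ?m)" by (rule gr_right_idealD(2)[OF K(1)])+
    show "add_subgroup N" by (rule N')
    show "K n \<subseteq> K ?m" by (rule antimono[OF that])
    have "K n \<inter> N = K n\<^sub>1 \<inter> N" "K ?m \<inter> N = K n\<^sub>1 \<inter> N"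
      by (rule n\<^sub>1[rule_format], use that in simp)+
    then show "K n \<inter> N = K ?m \<inter> N" by (simp only:)
    have "T n = T n\<^sub>2" "T ?m = T n\<^sub>2"
      by (rule n\<^sub>2, use that in simp)+
    then show "K n + N = K ?m + N" by (simp only: plus)
  qed
  then show "\<exists>m. \<forall>n\<ge>m. K n = K m" by (intro exI allI impI)
qed

text \<open>
  The finite sum appears only through an upper bound \<open>N\<close> of its summands, which is all that is
  needed to place \<open>1\<^sub>e R\<close> inside a right ideal with the chain condition.
\<close>

lemma finite_gr_simple_sum_dcc:
  assumes "finite F" "\<And>S. S \<in> F \<Longrightarrow> gr_simple G R S"
  shows "\<exists>N. gr_right_ideal G R N \<and> (\<forall>S\<in>F. S \<subseteq> N) \<and> dcc (\<lambda>U. gr_right_ideal G R U \<and> U \<subseteq> N)"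
  using assms
proof (induction F rule: finite_induct)
  case empty
  have zero: "U = {0}" if "gr_right_ideal G R U" "U \<subseteq> {0}" for U
    using add_subgroup_zero[OF gr_right_idealD(2)[OF that(1)]] that(2) by blast
  have "dcc (\<lambda>U. gr_right_ideal G R U \<and> U \<subseteq> {0})"
    unfolding dcc_def
  proof (intro allI impI, elim conjE)
    fix U :: "nat \<Rightarrow> 'a set"
    assume "\<forall>n. gr_right_ideal G R (U n) \<and> U n \<subseteq> {0}"
    then have "U n = {0}" for n by (intro zero) auto
    then show "\<exists>N. \<forall>n\<ge>N. U n = U N" by simp
  qed
  then show ?case using gr_right_ideal_zero by blast
next
  case (insert S F)
  have "\<exists>N. gr_right_ideal G R N \<and> (\<forall>S\<in>F. S \<subseteq> N) \<and> dcc (\<lambda>U. gr_right_ideal G R U \<and> U \<subseteq> N)"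
    by (rule insert.IH) (simp add: insert.prems)
  then obtain N where N: "gr_right_ideal G R N" "\<forall>S\<in>F. S \<subseteq> N"
    "dcc (\<lambda>U. gr_right_ideal G R U \<and> U \<subseteq> N)" by (elim exE conjE)
  have S: "gr_simple G R S" using insert.prems by simp
  show ?case
  proof (intro exI[where x = "N + S"] conjI)
    show "gr_right_ideal G R (N + S)" using N(1) gr_simpleD[OF S] by (rule gr_right_ideal_set_plus)
    have "N \<subseteq> N + S" "S \<subseteq> N + S"
      by (rule subset_set_plus_left[OF gr_right_idealD(2)[OF gr_simpleD[OF S]]])
        (rule subset_set_plus_right[OF gr_right_idealD(2)[OF N(1)]])
    then show "\<forall>S'\<in>insert S F. S' \<subseteq> N + S" using N(2) by auto
    show "dcc (\<lambda>U. gr_right_ideal G R U \<and> U \<subseteq> N + S)"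
      using N(1) S N(3) by (rule dcc_set_plus_gr_simple)
  qed
qed

lemma right_objects_artinian_if_semisimple:
  assumes "gr_semisimple_ring G R"
  shows "right_objects_artinian G d R un"
  unfolding right_objects_artinian_def
proof
  fix e
  obtain \<S> where \<S>: "\<forall>U\<in>\<S>. gr_simple G R U" "internal_sum \<S> (\<lambda>U. U) = UNIV"
    using assms by (auto simp: gr_semisimple_ring_def)
  then have "un e \<in> internal_sum \<S> (\<lambda>U. U)" by simp
  then obtain f where f: "f \<in> fin_supp_families \<S> (\<lambda>U. U)" "un e = family_total f"
    by (auto simp: internal_sum_def)
  \<comment> \<open>Only finitely many gr-simple right ideals contribute to \<open>1\<^sub>e\<close>, and their sum contains \<open>1\<^sub>e R\<close>.\<close>
  let ?F = "{U. f U \<noteq> 0}"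
  have F: "finite ?F" "?F \<subseteq> \<S>" using f(1) by (auto simp: fin_supp_families_def)
  then obtain N where N: "gr_right_ideal G R N" "\<forall>S\<in>?F. S \<subseteq> N"
    "dcc (\<lambda>U. gr_right_ideal G R U \<and> U \<subseteq> N)"
    using finite_gr_simple_sum_dcc[of ?F] \<S>(1) by blast
  have "f U \<in> N" if "U \<in> ?F" for U
    using that N(2) F(2) f(1) by (auto simp: fin_supp_families_def)
  then have "un e \<in> N"
    unfolding f(2) family_total_def by (intro add_subgroup_sum gr_right_idealD(2)[OF N(1)])
  then have "right_mult_set (un e) \<subseteq> N"
    by (intro right_mult_set_subset gr_right_idealD(1)[OF N(1)])
  then show "dcc (\<lambda>U. gr_right_ideal G R U \<and> U \<subseteq> right_mult_set (un e))"
    using N(3) by (elim dcc_mono) blast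
qed

section \<open>The graded radical\<close>

text \<open>
  In a sum of gr-simple right ideals, a graded right ideal that is maximal with respect to avoiding
  one given element is already gr-maximal: any \<open>V\<close> strictly between it and the ring leaves room for
  a gr-simple summand that is independent of \<open>V\<close> and can be added without reaching that element.
\<close>

lemma gr_radical_zero_if_semisimple:
  assumes "gr_semisimple_ring G R"
  shows "gr_radical G R = {0}"
proof -
  obtain \<S> where \<S>: "\<And>U. U \<in> \<S> \<Longrightarrow> gr_simple G R U" "internal_sum \<S> (\<lambda>U. U) = UNIV"
    using assms by (auto simp: gr_semisimple_ring_def)
  have "a \<notin> gr_radical G R" if "a \<noteq> 0" for a
  proof -
    let ?A = "{U. gr_right_ideal G R U \<and> a \<notin> U}"
    have "?A \<noteq> {}" using gr_right_ideal_zero that by blast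
    moreover have "\<Union>\<C> \<in> ?A" if "\<C> \<noteq> {}" "subset.chain ?A \<C>" for \<C>
      using that gr_right_ideal_Union_chain[of \<C>] by (auto simp: subset_chain_def)
    ultimately obtain M where "M \<in> ?A" and max: "\<And>V. V \<in> ?A \<Longrightarrow> M \<subseteq> V \<Longrightarrow> V = M"
      using subset_Zorn_nonempty[of ?A] by blast
    then have M: "gr_right_ideal G R M" "a \<notin> M" by auto
    have "V = M" if V: "gr_right_ideal G R V" "V \<noteq> UNIV" "M \<subseteq> V" for V
    proof (rule ccontr)
      assume "V \<noteq> M"
      then have aV: "a \<in> V" using max[of V] V by auto
      obtain S where S: "S \<in> \<S>" "\<not> S \<subseteq> V"
        using internal_sum_least[OF gr_right_idealD(2)[OF V(1)], of \<S> "\<lambda>U. U"] \<S>(2) V(2) by auto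
      note simple = \<S>(1)[OF S(1)]
      \<comment> \<open>Modular law: \<open>a\<close> lies in \<open>V\<close>, and \<open>(M + S) \<inter> V = M\<close> because \<open>S \<inter> V = 0\<close>.\<close>
      have "a \<notin> M + S"
      proof
        assume "a \<in> M + S"
        then obtain m s where ms: "a = m + s" "m \<in> M" "s \<in> S" by (rule set_plus_elim)
        have "a - m \<in> V"
          using aV ms V(3) by (blast intro: add_subgroup_diff gr_right_idealD(2)[OF V(1)])
        then have "s = 0" using ms gr_simple_Int_trivial[OF simple V(1) S(2)] by auto
        then show False using ms M(2) by simp
      qed
      then have "M + S = M"
        using max[of "M + S"] gr_right_ideal_set_plus[OF M(1) gr_simpleD[OF simple]]
          subset_set_plus_left[OF gr_right_idealD(2)[OF gr_simpleD[OF simple]]] by blast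
      then show False
        using S(2) V(3) subset_set_plus_right[OF gr_right_idealD(2)[OF M(1)], of S] by blast
    qed
    then have "gr_maximal G R M" using M unfolding gr_maximal_def by blast
    then show ?thesis using M(2) unfolding gr_radical_def by blast
  qed
  moreover have "0 \<in> gr_radical G R"
    using gr_right_idealD(2) add_subgroup_zero by (auto simp: gr_radical_def gr_maximal_def)
  ultimately show ?thesis by blast
qed

text \<open>
  Some gr-maximal \<open>M\<close> misses part of \<open>S\<close>, because the radical is zero; by maximality it is a
  complement of \<open>S\<close>. Its intersection with \<open>S\<close> is then zero by \<open>gr_simple_Int_trivial\<close>.
\<close>

lemma gr_simple_has_complement:
  assumes "gr_radical G R = {0}" "gr_simple G R S"
  obtains M where "gr_right_ideal G R M" "\<not> S \<subseteq> M" "S + M = UNIV"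
proof -
  have S: "gr_right_ideal G R S" "S \<noteq> {0}" using assms(2) by (auto simp: gr_simple_def)
  then obtain s where "s \<in> S" "s \<noteq> 0"
    using gr_right_idealD(2) add_subgroup_zero by blast
  then have "s \<notin> gr_radical G R" using assms(1) by simp
  then obtain M where M: "gr_maximal G R M" "s \<notin> M" by (auto simp: gr_radical_def)
  then have M': "gr_right_ideal G R M" by (simp add: gr_maximal_def)
  have nsub: "\<not> S \<subseteq> M" using \<open>s \<in> S\<close> M(2) by blast
  have "M \<subseteq> S + M" "S \<subseteq> S + M"
    using S(1) M' by (simp_all add: subset_set_plus_left subset_set_plus_right gr_right_idealD)
  then have "S + M = UNIV"
    using M(1) nsub gr_right_ideal_set_plus[OF S(1) M'] unfolding gr_maximal_def by blast
  with M' nsub show ?thesis by (rule that)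
qed

section \<open>The chain condition on gr-principal right ideals\<close>

lemma dcc_principal_if_artinian:
  assumes "right_objects_artinian G d R un"
  shows "dcc (gr_principal G R)"
  unfolding dcc_def
proof (intro allI impI, elim conjE)
  fix U :: "nat \<Rightarrow> 'a set"
  assume P: "\<forall>n. gr_principal G R (U n)" and desc: "\<forall>n. U (Suc n) \<subseteq> U n"
  obtain \<gamma> a where a: "\<gamma> \<in> G" "a \<in> R \<gamma>" "U 0 = right_mult_set a"
    using P unfolding gr_principal_def homogeneous_def by blast
  have "un (r \<gamma>) * a = a" using a by (intro un_left)
  then have "a \<in> right_mult_set (un (r \<gamma>))"
    unfolding right_mult_set_def by (metis rangeI)
  then have "U 0 \<subseteq> right_mult_set (un (r \<gamma>))"
    unfolding a(3) by (rule right_mult_set_subset[OF right_ideal_right_mult_set])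
  moreover have "U n \<subseteq> U 0" for n
    using lift_Suc_antimono_le[of U 0 n] desc by blast
  ultimately have "\<forall>n. gr_right_ideal G R (U n) \<and> U n \<subseteq> right_mult_set (un (r \<gamma>))"
    using P unfolding gr_principal_def by blast
  moreover have "r \<gamma> \<in> objects G d" using a by (simp add: objects_def r_closed d_r)
  ultimately show "\<exists>N. \<forall>n\<ge>N. U n = U N"
    using assms desc unfolding right_objects_artinian_def dcc_def by blast
qed

text \<open>
  A minimal nonzero gr-principal right ideal is gr-simple, since a nonzero graded right ideal
  contains a nonzero gr-principal one.
\<close>

lemma gr_principal_contains_gr_simple:
  assumes "dcc (gr_principal G R)" "gr_principal G R U" "U \<noteq> {0}"
  obtains S where "gr_simple G R S" "S \<subseteq> U"
proof -
  obtain S where S: "gr_principal G R S" "S \<noteq> {0} \<and> S \<subseteq> U"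
    and min: "\<forall>W. gr_principal G R W \<longrightarrow> W \<noteq> {0} \<and> W \<subseteq> U \<longrightarrow> W \<subseteq> S \<longrightarrow> W = S"
    using dcc_minimal[OF assms(1,2), of "\<lambda>W. W \<noteq> {0} \<and> W \<subseteq> U"] assms(3) by auto
  have "V = S" if V: "gr_right_ideal G R V" "V \<subseteq> S" "V \<noteq> {0}" for V
  proof -
    obtain \<gamma> b where b: "\<gamma> \<in> G" "b \<in> R \<gamma>" "b \<in> V" "b \<noteq> 0"
      by (rule nonzero_homogeneous_mem[OF V(1,3)])
    have sub: "right_mult_set b \<subseteq> V"
      by (rule right_mult_set_subset[OF gr_right_idealD(1)[OF V(1)] b(3)])
    have "right_mult_set b = S"
      by (rule min[rule_format])
        (use b gr_principal_right_mult_set[OF b(1,2)] mem_right_mult_set[OF b(1,2)] sub V(2) S(2)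
          in blast)+
    then show ?thesis using sub V(2) by blast
  qed
  moreover have "gr_right_ideal G R S" using S(1) by (simp add: gr_principal_def)
  ultimately have "gr_simple G R S" using S(2) unfolding gr_simple_def by blast
  then show ?thesis using that S(2) by blast
qed

text \<open>
  Subtracting elements of gr-simple right ideals from a homogeneous element \<open>a\<close> makes the
  gr-principal right ideal that it generates smaller and smaller; the chain condition forces this
  process to end at \<open>0\<close>, so that \<open>a\<close> is a sum of the subtracted elements.
\<close>

lemma gr_semisimple_if_dcc_principal:
  assumes rad: "gr_radical G R = {0}" and dcc: "dcc (gr_principal G R)"
  shows "gr_semisimple_ring G R"
proof -
  define soc where "soc = internal_sum {S. gr_simple G R S} (\<lambda>S. S)"
  have simple_subgroup: "add_subgroup S" if "S \<in> {S. gr_simple G R S}" for S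
    using that gr_simpleD gr_right_idealD(2) by blast
  have soc: "add_subgroup soc"
    unfolding soc_def by (rule internal_sum_add_subgroup) (rule simple_subgroup)
  have simple_soc: "S \<subseteq> soc" if "gr_simple G R S" for S
    unfolding soc_def
    by (rule internal_sum_upper[where A = "\<lambda>S. S"]) (use that simple_subgroup in auto)
  have "R \<gamma> \<subseteq> soc" if \<gamma>: "\<gamma> \<in> G" for \<gamma>
  proof
    fix a assume a: "a \<in> R \<gamma>"
    let ?Q = "\<lambda>U. \<exists>f\<in>R \<gamma>. a - f \<in> soc \<and> U = right_mult_set f"
    have "?Q (right_mult_set a)" using a add_subgroup_zero[OF soc] by (intro bexI[of _ a]) simp_all
    then have "\<exists>U. gr_principal G R U \<and> ?Q U \<and>
        (\<forall>W. gr_principal G R W \<longrightarrow> ?Q W \<longrightarrow> W \<subseteq> U \<longrightarrow> W = U)"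
      by (rule dcc_minimal[OF dcc gr_principal_right_mult_set[OF \<gamma> a]])
    then obtain U where "gr_principal G R U" "?Q U"
      and min: "\<forall>W. gr_principal G R W \<longrightarrow> ?Q W \<longrightarrow> W \<subseteq> U \<longrightarrow> W = U"
      by (elim exE conjE)
    then obtain f where f: "f \<in> R \<gamma>" "a - f \<in> soc" "U = right_mult_set f" by blast
    have "f = 0"
    proof (rule ccontr)
      assume "f \<noteq> 0"
      then have "U \<noteq> {0}" using mem_right_mult_set[OF \<gamma> f(1)] f(3) by auto
      obtain S where S: "gr_simple G R S" "S \<subseteq> U"
        by (rule gr_principal_contains_gr_simple[OF dcc, of U])
          (simp_all add: f(3) gr_principal_right_mult_set[OF \<gamma> f(1)] \<open>U \<noteq> {0}\<close>[unfolded f(3)])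
      obtain M where M: "gr_right_ideal G R M" "\<not> S \<subseteq> M" "S + M = UNIV"
        by (rule gr_simple_has_complement[OF rad S(1)])
      have "f \<in> S + M" using M(3) by simp
      then obtain s m where sm: "f = s + m" "s \<in> S" "m \<in> M" by (rule set_plus_elim)
      \<comment> \<open>Passing to components of degree \<open>\<gamma>\<close> makes the remainder homogeneous of the degree of \<open>a\<close>.\<close>
      define s' m' where "s' = hcomp s \<gamma>" and "m' = hcomp m \<gamma>"
      have eq: "f = s' + m'"
        using hcomp_homogeneous[OF \<gamma> f(1), of \<gamma>] by (simp add: s'_def m'_def sm(1) hcomp_add)
      have s': "s' \<in> S" using gr_simpleD[OF S(1)] sm(2) by (simp add: gr_right_ideal_iff s'_def)
      have m': "m' \<in> M" using M(1) sm(3) by (simp add: gr_right_ideal_iff m'_def)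
      have m'_hom: "m' \<in> R \<gamma>" using \<gamma> by (simp add: m'_def hcomp_mem)
      have "(a - f) + s' \<in> soc"
        by (rule add_subgroup_add[OF soc f(2) subsetD[OF simple_soc[OF S(1)] s']])
      moreover have "(a - f) + s' = a - m'" by (simp add: eq)
      ultimately have Q: "?Q (right_mult_set m')"
        using m'_hom by (intro bexI[of _ m']) simp_all
      have U: "right_ideal U" "f \<in> U"
        using right_ideal_right_mult_set mem_right_mult_set[OF \<gamma> f(1)] by (simp_all add: f(3))
      have "f - s' \<in> U"
        by (rule add_subgroup_diff[OF right_ideal_add_subgroup[OF U(1)] U(2) subsetD[OF S(2) s']])
      then have "m' \<in> U" by (simp add: eq)
      then have "right_mult_set m' \<subseteq> U" by (rule right_mult_set_subset[OF U(1)])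
      then have "right_mult_set m' = U"
        by (rule min[rule_format, OF gr_principal_right_mult_set[OF \<gamma> m'_hom] Q])
      moreover have "right_mult_set m' \<subseteq> M"
        by (rule right_mult_set_subset[OF gr_right_idealD(1)[OF M(1)] m'])
      ultimately show False using S(2) M(2) by simp
    qed
    then show "a \<in> soc" using f(2) by simp
  qed
  then have "internal_sum G R \<subseteq> soc" by (rule internal_sum_least[OF soc])
  moreover have "internal_sum G R = UNIV"
    unfolding internal_sum_def by (rule bij_betw_imp_surj_on[OF family_total_bij])
  ultimately have "soc = UNIV" by (simp add: top.extremum_unique)
  then show ?thesis
    unfolding gr_semisimple_ring_def soc_def by (intro exI[of _ "{S. gr_simple G R S}"]) simp
qed

end

theorem theorem5p11:
  fixes G :: "'g set"
    and d r :: "'g \<Rightarrow> 'g"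
    and cmp :: "'g \<Rightarrow> 'g \<Rightarrow> 'g"
    and R :: "'g \<Rightarrow> 'a::ring set"
    and un :: "'g \<Rightarrow> 'a"
  assumes "object_unital_graded_ring G d r cmp R un"
  shows "(gr_semisimple_ring G R \<longleftrightarrow>
            gr_radical G R = {0} \<and> right_objects_artinian G d R un) \<and>
         (gr_radical G R = {0} \<and> right_objects_artinian G d R un \<longleftrightarrow>
            gr_radical G R = {0} \<and> dcc (gr_principal G R))"
proof -
  interpret object_unital_graded_ring G d r cmp R un by (rule assms)
  show ?thesis
    using gr_radical_zero_if_semisimple right_objects_artinian_if_semisimple
      dcc_principal_if_artinian gr_semisimple_if_dcc_principal by blast
qed

end
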